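(* Let $\alpha,\beta\in\mathcal{DP}_n$. Then, with the preorders taken in the semigroup $\mathcal{DP}_n$: (1) $\alpha\le_{\mathcal R}\beta$ if and only if $\mathrm{Dom}\,\alpha\subseteq\mathrm{Dom}\,\beta$; (2) $\alpha\le_{\mathcal L}\beta$ if and only if $\mathrm{Im}\,\alpha\subseteq\mathrm{Im}\,\beta$; (3) $\alpha\le_{\mathcal H}\beta$ if and only if $\mathrm{Dom}\,\alpha\subseteq\mathrm{Dom}\,\beta$ and $\mathrm{Im}\,\alpha\subseteq\mathrm{Im}\,\beta$.
   Context: For $n\ge 0$ let $X_n=\{1,2,\dots,n\}$ and let $\mathcal{I}_n$ be the symmetric inverse semigroup of all partial injective maps of $X_n$ (including the empty map). Maps are written on the right and composed left to right: $x(\alpha\beta)=(x\alpha)\beta$. $\mathcal{DP}_n$ is the subsemigroup of all $\alpha\in\mathcal{I}_n$ with $|x-y|=|x\alpha-y\alpha|$ for all $x,y\in\mathrm{Dom}\,\alpha$ (partial isometries); it contains the identity of $X_n$. For a monoid $S$ and $a,b\in S$: $a\le_{\mathcal R}b$ means $a=bs$ for some $s\in S$; $a\le_{\mathcal L}b$ means $a=sb$ for some $s\in S$; $a\le_{\mathcal H}b$ means $a\le_{\mathcal R}b$ and $a\le_{\mathcal L}b$. *)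

theory Defs
  imports "HOL-Algebra.Group"
begin

text \<open>
  A partial map of X_n is a \<open>nat \<rightharpoonup> nat\<close>; \<open>dom\<close> and \<open>ran\<close> are its domain and image.
\<close>

definition X :: "nat \<Rightarrow> nat set" where
  "X n = {1..n}"

text \<open>
  Maps act on the right, so the product of \<open>\<alpha>\<close> and \<open>\<beta>\<close> applies \<open>\<alpha>\<close> first, whereas in
  \<open>\<beta> \<circ>\<^sub>m \<alpha>\<close> the map applied first stands on the right.
\<close>

definition sym_inv :: "nat \<Rightarrow> (nat \<rightharpoonup> nat) monoid" where
  "sym_inv n =
     \<lparr>carrier = {\<alpha>. dom \<alpha> \<subseteq> X n \<and> ran \<alpha> \<subseteq> X n \<and> inj_on \<alpha> (dom \<alpha>)},
      mult = (\<lambda>\<alpha> \<beta>. \<beta> \<circ>\<^sub>m \<alpha>),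
      one = Some |` X n\<rparr>"

definition partial_isometry :: "(nat \<rightharpoonup> nat) \<Rightarrow> bool" where
  "partial_isometry \<alpha> \<longleftrightarrow>
     (\<forall>x\<in>dom \<alpha>. \<forall>y\<in>dom \<alpha>.
        \<bar>int x - int y\<bar> = \<bar>int (the (\<alpha> x)) - int (the (\<alpha> y))\<bar>)"

definition DP :: "nat \<Rightarrow> (nat \<rightharpoonup> nat) monoid" where
  "DP n = (sym_inv n)\<lparr>carrier := {\<alpha> \<in> carrier (sym_inv n). partial_isometry \<alpha>}\<rparr>"

definition le_R :: "('a, 'b) monoid_scheme \<Rightarrow> 'a \<Rightarrow> 'a \<Rightarrow> bool" where
  "le_R S a b \<longleftrightarrow> (\<exists>s\<in>carrier S. a = b \<otimes>\<^bsub>S\<^esub> s)"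

definition le_L :: "('a, 'b) monoid_scheme \<Rightarrow> 'a \<Rightarrow> 'a \<Rightarrow> bool" where
  "le_L S a b \<longleftrightarrow> (\<exists>s\<in>carrier S. a = s \<otimes>\<^bsub>S\<^esub> b)"

definition le_H :: "('a, 'b) monoid_scheme \<Rightarrow> 'a \<Rightarrow> 'a \<Rightarrow> bool" where
  "le_H S a b \<longleftrightarrow> le_R S a b \<and> le_L S a b"

lemma dom_ran_map_comp:
  "dom (\<beta> \<circ>\<^sub>m \<alpha>) \<subseteq> dom \<alpha>" "ran (\<beta> \<circ>\<^sub>m \<alpha>) \<subseteq> ran \<beta>"
  by (auto simp: map_comp_def ran_def split: option.splits)

lemma inj_on_map_comp:
  assumes "inj_on \<alpha> (dom \<alpha>)" "inj_on \<beta> (dom \<beta>)"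
  shows "inj_on (\<beta> \<circ>\<^sub>m \<alpha>) (dom (\<beta> \<circ>\<^sub>m \<alpha>))"
proof (rule inj_onI)
  fix x y
  assume "x \<in> dom (\<beta> \<circ>\<^sub>m \<alpha>)" "y \<in> dom (\<beta> \<circ>\<^sub>m \<alpha>)" and eq: "(\<beta> \<circ>\<^sub>m \<alpha>) x = (\<beta> \<circ>\<^sub>m \<alpha>) y"
  then obtain a b c d where ab: "\<alpha> x = Some a" "\<alpha> y = Some b" "\<beta> a = Some c" "\<beta> b = Some d"
    by (auto simp: map_comp_def split: option.splits)
  then have "\<beta> a = \<beta> b" using eq by simp
  then have "a = b" using inj_onD[OF assms(2)] ab by blast
  then show "x = y" using inj_onD[OF assms(1)] ab by (metis domI)
qed

lemma partial_isometry_map_comp: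
  assumes "partial_isometry \<alpha>" "partial_isometry \<beta>"
  shows "partial_isometry (\<beta> \<circ>\<^sub>m \<alpha>)"
  unfolding partial_isometry_def
proof (intro ballI)
  fix x y
  assume "x \<in> dom (\<beta> \<circ>\<^sub>m \<alpha>)" "y \<in> dom (\<beta> \<circ>\<^sub>m \<alpha>)"
  then obtain a b c d where ab: "\<alpha> x = Some a" "\<alpha> y = Some b" "\<beta> a = Some c" "\<beta> b = Some d"
    by (auto simp: map_comp_def split: option.splits)
  have "\<bar>int x - int y\<bar> = \<bar>int a - int b\<bar>"
    using assms(1) ab unfolding partial_isometry_def by (metis domI option.sel)
  moreover have "\<bar>int a - int b\<bar> = \<bar>int c - int d\<bar>"
    using assms(2) ab unfolding partial_isometry_def by (metis domI option.sel)
  ultimately show "\<bar>int x - int y\<bar> =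
      \<bar>int (the ((\<beta> \<circ>\<^sub>m \<alpha>) x)) - int (the ((\<beta> \<circ>\<^sub>m \<alpha>) y))\<bar>"
    using ab by simp
qed

lemma map_comp_assoc: "\<gamma> \<circ>\<^sub>m (\<beta> \<circ>\<^sub>m \<alpha>) = (\<gamma> \<circ>\<^sub>m \<beta>) \<circ>\<^sub>m \<alpha>"
  by (auto simp: map_comp_def fun_eq_iff split: option.splits)

lemma map_comp_restrict_id_right:
  assumes "dom \<alpha> \<subseteq> A"
  shows "\<alpha> \<circ>\<^sub>m (Some |` A) = \<alpha>"
proof
  fix x
  show "(\<alpha> \<circ>\<^sub>m (Some |` A)) x = \<alpha> x"
    using assms by (cases "\<alpha> x") (auto simp: map_comp_def restrict_map_def)
qed

lemma map_comp_restrict_id_left: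
  assumes "ran \<alpha> \<subseteq> A"
  shows "(Some |` A) \<circ>\<^sub>m \<alpha> = \<alpha>"
proof
  fix x
  show "((Some |` A) \<circ>\<^sub>m \<alpha>) x = \<alpha> x"
    using assms by (cases "\<alpha> x") (auto simp: restrict_map_def ran_def)
qed

lemma restrict_id_facts:
  "dom (Some |` A) = A" "ran (Some |` A) = A" "inj_on (Some |` A) A"
  by (auto simp: restrict_map_def ran_def inj_on_def dom_def split: if_splits)

lemma partial_isometry_restrict_id: "partial_isometry (Some |` A)"
  by (auto simp: partial_isometry_def restrict_map_def split: if_splits)

lemma monoid_sym_inv: "monoid (sym_inv n)"
proof (rule monoidI)
  fix \<alpha> \<beta> assume "\<alpha> \<in> carrier (sym_inv n)" "\<beta> \<in> carrier (sym_inv n)"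
  then show "\<alpha> \<otimes>\<^bsub>sym_inv n\<^esub> \<beta> \<in> carrier (sym_inv n)"
    using dom_ran_map_comp[of \<beta> \<alpha>] inj_on_map_comp[of \<alpha> \<beta>]
    by (auto simp: sym_inv_def)
qed (simp_all add: sym_inv_def restrict_id_facts map_comp_assoc
      map_comp_restrict_id_left map_comp_restrict_id_right)

lemma submonoid_DP: "submonoid (carrier (DP n)) (sym_inv n)"
proof (rule submonoid.intro)
  fix \<alpha> \<beta> assume "\<alpha> \<in> carrier (DP n)" "\<beta> \<in> carrier (DP n)"
  then show "\<alpha> \<otimes>\<^bsub>sym_inv n\<^esub> \<beta> \<in> carrier (DP n)"
    using monoid.m_closed[OF monoid_sym_inv, of \<alpha> n \<beta>] partial_isometry_map_comp[of \<alpha> \<beta>]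
    by (auto simp: DP_def) (simp add: sym_inv_def)
qed (use monoid.one_closed[OF monoid_sym_inv] partial_isometry_restrict_id in
      \<open>auto simp: DP_def sym_inv_def\<close>)

lemma monoid_DP: "monoid (DP n)"
  using submonoid.submonoid_is_monoid[OF submonoid_DP monoid_sym_inv, of n]
  by (simp add: DP_def)

end

theory Submission imports Defs
begin

text \<open>
  The inverse of a partial isometry is again one, so \<open>DP n\<close> is an inverse monoid, and the missing
  factor can be taken to be \<open>\<beta>\<inverse>\<alpha>\<close> for the \<open>\<R>\<close>-order and \<open>\<alpha>\<beta>\<inverse>\<close> for the \<open>\<L>\<close>-order.
\<close>

definition map_inv :: "('a \<rightharpoonup> 'b) \<Rightarrow> 'b \<rightharpoonup> 'a" where
  "map_inv f y = (if y \<in> ran f then Some (SOME x. f x = Some y) else None)"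

text \<open>Injectivity leaves \<open>SOME\<close> only one preimage to pick. This transposition of
  the graph lets later arguments avoid the choice operator.\<close>

lemma map_inv_eq_Some_iff:
  assumes "inj_on f (dom f)"
  shows "map_inv f y = Some x \<longleftrightarrow> f x = Some y"
proof
  assume "map_inv f y = Some x"
  then show "f x = Some y"
    by (auto simp: map_inv_def ran_def split: if_splits intro: someI)
next
  assume x: "f x = Some y"
  then have "f (SOME x. f x = Some y) = Some y" by (rule someI)
  then have "(SOME x. f x = Some y) = x"
    using x inj_onD[OF assms] by (metis domI)
  then show "map_inv f y = Some x"
    using x by (auto simp: map_inv_def ran_def)
qed

lemma dom_map_inv: "dom (map_inv f) = ran f"
  by (auto simp: map_inv_def split: if_splits)

lemma ran_map_inv: "inj_on f (dom f) \<Longrightarrow> ran (map_inv f) = dom f"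
  by (auto simp: ran_def map_inv_eq_Some_iff)

lemma inj_on_map_inv:
  assumes "inj_on f (dom f)"
  shows "inj_on (map_inv f) (dom (map_inv f))"
proof (rule inj_onI)
  fix y z
  assume "y \<in> dom (map_inv f)" and eq: "map_inv f y = map_inv f z"
  \<comment> \<open>As \<open>y\<close> lies in the domain, the common value is not
    \<open>None\<close>; transposing, \<open>f x\<close> is both \<open>Some y\<close> and
    \<open>Some z\<close>.\<close>
  then obtain x where "map_inv f y = Some x" "map_inv f z = Some x" by (metis domD)
  then show "y = z" by (simp add: map_inv_eq_Some_iff[OF assms])
qed

text \<open>With maps acting on the right this is the idempotent \<open>f\<close> times its inverse,
  a left identity for every map whose domain lies in \<open>dom f\<close>.\<close>

lemma map_inv_comp:
  assumes "inj_on f (dom f)"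
  shows "map_inv f \<circ>\<^sub>m f = Some |` dom f"
proof
  fix x
  show "(map_inv f \<circ>\<^sub>m f) x = (Some |` dom f) x"
    by (cases "f x") (auto simp: restrict_map_def map_inv_eq_Some_iff[OF assms])
qed

text \<open>The opposite product gives a right identity for every map whose image lies in
  \<open>ran f\<close>.\<close>

lemma comp_map_inv:
  assumes "inj_on f (dom f)"
  shows "f \<circ>\<^sub>m map_inv f = Some |` ran f"
proof
  fix y
  show "(f \<circ>\<^sub>m map_inv f) y = (Some |` ran f) y"
  proof (cases "map_inv f y")
    case None
    then have "y \<notin> ran f" using dom_map_inv[of f] by blast
    with None show ?thesis by simp
  next
    case (Some x)
    then have "f x = Some y" by (simp add: map_inv_eq_Some_iff[OF assms])
    with Some show ?thesis by (auto simp: restrict_map_def ran_def)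
  qed
qed

text \<open>The distance condition is symmetric between points and their images, so it survives
  exchanging the two.\<close>

lemma partial_isometry_map_inv:
  assumes "inj_on f (dom f)" "partial_isometry f"
  shows "partial_isometry (map_inv f)"
  unfolding partial_isometry_def
proof (intro ballI)
  fix y z
  assume "y \<in> dom (map_inv f)" "z \<in> dom (map_inv f)"
  then obtain a b where ab: "map_inv f y = Some a" "map_inv f z = Some b" by auto
  then have "f a = Some y" "f b = Some z" by (simp_all add: map_inv_eq_Some_iff[OF assms(1)])
  then have "\<bar>int a - int b\<bar> = \<bar>int y - int z\<bar>"
    using assms(2) unfolding partial_isometry_def by (metis domI option.sel)
  then show "\<bar>int y - int z\<bar> = \<bar>int (the (map_inv f y)) - int (the (map_inv f z))\<bar>"
    using ab by simp
qed

lemma carrier_DP_iff: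
  "\<alpha> \<in> carrier (DP n) \<longleftrightarrow>
     dom \<alpha> \<subseteq> X n \<and> ran \<alpha> \<subseteq> X n \<and> inj_on \<alpha> (dom \<alpha>) \<and> partial_isometry \<alpha>"
  by (simp add: DP_def sym_inv_def)

lemma mult_DP: "\<alpha> \<otimes>\<^bsub>DP n\<^esub> \<beta> = \<beta> \<circ>\<^sub>m \<alpha>"
  by (simp add: DP_def sym_inv_def)

lemma map_inv_closed_DP: "\<alpha> \<in> carrier (DP n) \<Longrightarrow> map_inv \<alpha> \<in> carrier (DP n)"
  using inj_on_map_inv[of \<alpha>]
  by (simp add: carrier_DP_iff dom_map_inv ran_map_inv partial_isometry_map_inv)

lemma le_R_DP_iff:
  assumes "\<alpha> \<in> carrier (DP n)" "\<beta> \<in> carrier (DP n)"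
  shows "le_R (DP n) \<alpha> \<beta> \<longleftrightarrow> dom \<alpha> \<subseteq> dom \<beta>"
proof
  assume "le_R (DP n) \<alpha> \<beta>"
  then obtain s where "\<alpha> = \<beta> \<otimes>\<^bsub>DP n\<^esub> s"
    unfolding le_R_def by blast
  \<comment> \<open>The factor \<open>s\<close> acts after \<beta>, so it can only shrink the
    domain.\<close>
  then show "dom \<alpha> \<subseteq> dom \<beta>"
    by (simp only: mult_DP dom_ran_map_comp)
next
  assume sub: "dom \<alpha> \<subseteq> dom \<beta>"
  let ?s = "map_inv \<beta> \<otimes>\<^bsub>DP n\<^esub> \<alpha>"
  have "?s \<in> carrier (DP n)"
    using assms by (intro monoid.m_closed[OF monoid_DP] map_inv_closed_DP)
  \<comment> \<open>Reassociating puts \<beta> next to its inverse; their product is the identity on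
    \<open>dom \<beta>\<close>, which contains \<open>dom \<alpha>\<close>, so it is absorbed by
    \<alpha>.\<close>
  moreover have "\<alpha> = \<beta> \<otimes>\<^bsub>DP n\<^esub> ?s"
    using assms(2) sub
    by (simp add: mult_DP carrier_DP_iff map_comp_assoc[symmetric] map_inv_comp
        map_comp_restrict_id_right)
  ultimately show "le_R (DP n) \<alpha> \<beta>" unfolding le_R_def by blast
qed

lemma le_L_DP_iff:
  assumes "\<alpha> \<in> carrier (DP n)" "\<beta> \<in> carrier (DP n)"
  shows "le_L (DP n) \<alpha> \<beta> \<longleftrightarrow> ran \<alpha> \<subseteq> ran \<beta>"
proof
  assume "le_L (DP n) \<alpha> \<beta>"
  then obtain s where "\<alpha> = s \<otimes>\<^bsub>DP n\<^esub> \<beta>"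
    unfolding le_L_def by blast
  \<comment> \<open>Here \<open>s\<close> acts before \<beta>, so every value of the product is a
    value of \<beta>.\<close>
  then show "ran \<alpha> \<subseteq> ran \<beta>"
    by (simp only: mult_DP dom_ran_map_comp)
next
  assume sub: "ran \<alpha> \<subseteq> ran \<beta>"
  let ?s = "\<alpha> \<otimes>\<^bsub>DP n\<^esub> map_inv \<beta>"
  have "?s \<in> carrier (DP n)"
    using assms by (intro monoid.m_closed[OF monoid_DP] map_inv_closed_DP)
  \<comment> \<open>Dually, the inverse of \<beta> followed by \<beta> is the identity on
    \<open>ran \<beta>\<close>, which fixes all values of \<alpha>.\<close>
  moreover have "\<alpha> = ?s \<otimes>\<^bsub>DP n\<^esub> \<beta>"
    using assms(2) sub
    by (simp add: mult_DP carrier_DP_iff map_comp_assoc comp_map_inv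
        map_comp_restrict_id_left)
  ultimately show "le_L (DP n) \<alpha> \<beta>" unfolding le_L_def by blast
qed

theorem lemma2p1:
  fixes n :: nat and \<alpha> \<beta> :: "nat \<rightharpoonup> nat"
  assumes "\<alpha> \<in> carrier (DP n)" and "\<beta> \<in> carrier (DP n)"
  shows "(le_R (DP n) \<alpha> \<beta> \<longleftrightarrow> dom \<alpha> \<subseteq> dom \<beta>)
       \<and> (le_L (DP n) \<alpha> \<beta> \<longleftrightarrow> ran \<alpha> \<subseteq> ran \<beta>)
       \<and> (le_H (DP n) \<alpha> \<beta> \<longleftrightarrow> dom \<alpha> \<subseteq> dom \<beta> \<and> ran \<alpha> \<subseteq> ran \<beta>)"
  using assms by (simp add: le_H_def le_R_DP_iff le_L_DP_iff)

end
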